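(* Let $0<\alpha\le 1$, let $m,n$ be natural numbers, and let $L_n^m(\tfrac{x^\alpha}{\alpha})$ be the conformable associated Laguerre polynomial. Then for all $x>0$, $$L_n^m\!\left(\frac{x^\alpha}{\alpha}\right)=\frac{x^{-m\alpha}\,e^{\frac{x^\alpha}{\alpha}}}{\alpha^n\, n!}\,D^{n\alpha}\!\left[x^{(n+m)\alpha}e^{-\frac{x^\alpha}{\alpha}}\right].$$
   Context: For $0<\alpha\le 1$, the conformable derivative of order $\alpha$ of a function $f$ at $x>0$ is $D^\alpha f(x)=\lim_{\epsilon\to 0}\frac{f(x+\epsilon x^{1-\alpha})-f(x)}{\epsilon}$. $D^{j\alpha}$ denotes the $j$-fold composition $D^\alpha\circ\cdots\circ D^\alpha$ (with $D^0$ the identity), acting in the variable $x$. For a natural number $N$, the conformable Laguerre polynomial of order $N$ is $$L_N\!\left(\frac{x^\alpha}{\alpha}\right)=\sum_{k=0}^N (-1)^k \frac{N!}{\alpha^k\,(N-k)!\,(k!)^2}\,x^{k\alpha},$$ and the conformable associated Laguerre polynomial is defined by $$L_n^m\!\left(\frac{x^\alpha}{\alpha}\right)=(-1)^m D^{m\alpha}L_{n+m}\!\left(\frac{x^\alpha}{\alpha}\right).$$ *)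

theory Defs
  imports Complex_Main
begin

text \<open>The variable is meant to range over \<open>x > 0\<close>; values at other \<open>x\<close> carry no meaning.
  They do not influence the derivative at a positive point, since \<open>Lim (at 0)\<close> only sees
  \<open>f\<close> near \<open>x\<close>.\<close>

definition conf_deriv :: "real \<Rightarrow> (real \<Rightarrow> real) \<Rightarrow> real \<Rightarrow> real" where
  "conf_deriv \<alpha> f x =
     Lim (at 0) (\<lambda>\<epsilon>. (f (x + \<epsilon> * x powr (1 - \<alpha>)) - f x) / \<epsilon>)"

text \<open>\<open>conf_laguerre \<alpha> N x\<close> and \<open>conf_assoc_laguerre \<alpha> n m x\<close> stand for
  \<open>L\<^sub>N(x\<^sup>\<alpha>/\<alpha>)\<close> and \<open>L\<^sub>n\<^sup>m(x\<^sup>\<alpha>/\<alpha>)\<close>, as functions of \<open>x\<close>.\<close>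

definition conf_laguerre :: "real \<Rightarrow> nat \<Rightarrow> real \<Rightarrow> real" where
  "conf_laguerre \<alpha> N x =
     (\<Sum>k=0..N. (-1) ^ k * (fact N / (\<alpha> ^ k * fact (N - k) * (fact k)\<^sup>2)) * x powr (real k * \<alpha>))"

definition conf_assoc_laguerre :: "real \<Rightarrow> nat \<Rightarrow> nat \<Rightarrow> real \<Rightarrow> real" where
  "conf_assoc_laguerre \<alpha> n m x =
     (-1) ^ m * (conf_deriv \<alpha> ^^ m) (conf_laguerre \<alpha> (n + m)) x"

end

theory Submission imports Defs begin

text \<open>In the variable \<open>t = x\<^sup>\<alpha>/\<alpha>\<close> the conformable derivative is the ordinary derivative, so the
  claim is the classical Rodrigues formula for \<open>L\<^sub>n\<^sup>m(t)\<close>. Both sides are then expanded: the left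
  one by differentiating \<open>\<Sum>\<^sub>k (-1)\<^sup>k (n+m choose k) t\<^sup>k/k!\<close> termwise, the right one by Leibniz' rule
  for \<open>t\<^sup>n\<^sup>+\<^sup>m e\<^sup>-\<^sup>t\<close>. The coefficients agree after reversing the Leibniz sum.\<close>

text \<open>The limit is the ordinary derivative at \<epsilon> = 0 of \<open>f\<close> composed with
  an affine map of slope \<open>x powr (1 - \<alpha>)\<close>, so the chain rule applies.\<close>

lemma conf_deriv_eq:
  assumes "(f has_real_derivative d) (at x)"
  shows "conf_deriv \<alpha> f x = d * x powr (1 - \<alpha>)"
proof -
  have "((\<lambda>\<epsilon>. x + \<epsilon> * x powr (1 - \<alpha>)) has_real_derivative x powr (1 - \<alpha>)) (at 0)"
    by (auto intro!: derivative_eq_intros)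
  then have "((\<lambda>\<epsilon>. f (x + \<epsilon> * x powr (1 - \<alpha>))) has_real_derivative d * x powr (1 - \<alpha>)) (at 0)"
    using DERIV_chain2[where f = f and g = "\<lambda>\<epsilon>. x + \<epsilon> * x powr (1 - \<alpha>)" and x = 0] assms
    by simp
  then show ?thesis
    unfolding conf_deriv_def DERIV_def by (auto intro!: tendsto_Lim)
qed

text \<open>The inner derivative \<open>x powr (\<alpha> - 1)\<close> of x^\<alpha>/\<alpha> cancels
  the factor from \<open>conf_deriv_eq\<close>. Passing all derivatives as a sequence
  \<open>F\<close> lets each application reduce to checking a closed form.\<close>

lemma conf_deriv_funpow_eq:
  fixes F :: "nat \<Rightarrow> real \<Rightarrow> real"
  assumes "0 < \<alpha>"
    and F: "\<And>j t. 0 < t \<Longrightarrow> (F j has_real_derivative F (Suc j) t) (at t)"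
    and f: "\<And>x. 0 < x \<Longrightarrow> f x = F 0 (x powr \<alpha> / \<alpha>)"
    and "0 < x"
  shows "(conf_deriv \<alpha> ^^ j) f x = F j (x powr \<alpha> / \<alpha>)"
  using \<open>0 < x\<close>
proof (induction j arbitrary: x)
  case 0
  then show ?case using f by simp
next
  case (Suc j)
  have "((\<lambda>y. y powr \<alpha> / \<alpha>) has_real_derivative x powr (\<alpha> - 1)) (at x)"
    using Suc.prems \<open>0 < \<alpha>\<close> by (auto intro!: derivative_eq_intros)
  then have "((\<lambda>y. F j (y powr \<alpha> / \<alpha>)) has_real_derivative
      F (Suc j) (x powr \<alpha> / \<alpha>) * x powr (\<alpha> - 1)) (at x)"
    using Suc.prems \<open>0 < \<alpha>\<close> by (intro DERIV_chain2[OF F]) auto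
  \<comment> \<open>The induction hypothesis is an equality on the positive reals only; this set is
    open, so the derivative at \<open>x\<close> carries over.\<close>
  then have "((conf_deriv \<alpha> ^^ j) f has_real_derivative
      F (Suc j) (x powr \<alpha> / \<alpha>) * x powr (\<alpha> - 1)) (at x)"
    by (rule has_field_derivative_transform_within_open[where S = "{0<..}"])
      (use Suc in auto)
  then have "(conf_deriv \<alpha> ^^ Suc j) f x =
      F (Suc j) (x powr \<alpha> / \<alpha>) * (x powr (\<alpha> - 1) * x powr (1 - \<alpha>))"
    by (simp add: conf_deriv_eq)
  also have "x powr (\<alpha> - 1) * x powr (1 - \<alpha>) = 1"
    using Suc.prems by (simp flip: powr_add)
  finally show ?case by simp
qed

text \<open>The j-th derivative of t^k/k!. The case split is essential: for j > k truncated
  subtraction would yield 1 instead of 0.\<close>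

definition divided_power_deriv :: "nat \<Rightarrow> nat \<Rightarrow> real \<Rightarrow> real" where
  "divided_power_deriv k j t = (if j \<le> k then t ^ (k - j) / fact (k - j) else 0)"

lemma has_real_derivative_divided_power_deriv:
  "(divided_power_deriv k j has_real_derivative divided_power_deriv k (Suc j) t) (at t)"
proof (cases "j < k")
  case True
  then obtain i where "k - j = Suc i" "k - Suc j = i"
    by (metis Suc_diff_Suc)
  moreover have "((\<lambda>t. t ^ Suc i / fact (Suc i)) has_real_derivative t ^ i / fact i) (at t)"
    by (rule derivative_eq_intros refl | simp)+
  ultimately show ?thesis
    using True by (simp add: divided_power_deriv_def [abs_def])
qed (cases "j = k"; simp add: divided_power_deriv_def [abs_def])

text \<open>These sums are iterated forward differences of \<open>a\<close> at 0. Pascal's rule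
  shows that the difference of order j + 1 is the j-th difference of the first differences.\<close>

lemma alternating_binomial_sum_Suc:
  fixes a :: "nat \<Rightarrow> 'a::comm_ring_1"
  shows "(\<Sum>i\<le>Suc j. of_nat (Suc j choose i) * (-1) ^ (Suc j - i) * a i) =
    (\<Sum>i\<le>j. of_nat (j choose i) * (-1) ^ (j - i) * (a (Suc i) - a i))"
proof -
  have "(\<Sum>i\<le>Suc j. of_nat (Suc j choose i) * (-1) ^ (Suc j - i) * a i) =
      (-1) ^ Suc j * a 0 +
      ((\<Sum>i\<le>j. of_nat (j choose Suc i) * (-1) ^ (j - i) * a (Suc i)) +
       (\<Sum>i\<le>j. of_nat (j choose i) * (-1) ^ (j - i) * a (Suc i)))"
    by (subst sum.atMost_Suc_shift) (simp add: algebra_simps flip: sum.distrib)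
  moreover have "(-1) ^ Suc j * a 0 + (\<Sum>i\<le>j. of_nat (j choose Suc i) * (-1) ^ (j - i) * a (Suc i)) =
      (\<Sum>i\<le>Suc j. of_nat (j choose i) * (-1) ^ (Suc j - i) * a i)"
    by (subst sum.atMost_Suc_shift) simp
  \<comment> \<open>The top term vanishes because \<open>j choose Suc j\<close> is 0, and lowering
    the exponent by one flips the sign.\<close>
  moreover have "\<dots> = - (\<Sum>i\<le>j. of_nat (j choose i) * (-1) ^ (j - i) * a i)"
    by (simp add: Suc_diff_le binomial_eq_0 flip: sum_negf)
  ultimately show ?thesis
    by (simp add: sum_subtractf algebra_simps)
qed

text \<open>The product rule replaces each \<open>f i\<close> by \<open>f (Suc i) - f i\<close>,
  which is the recursion of \<open>alternating_binomial_sum_Suc\<close>.\<close>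

lemma has_real_derivative_leibniz_exp_neg:
  fixes f :: "nat \<Rightarrow> real \<Rightarrow> real"
  assumes "\<And>i. (f i has_real_derivative f (Suc i) t) (at t)"
  shows "((\<lambda>t. exp (-t) * (\<Sum>i\<le>j. of_nat (j choose i) * (-1) ^ (j - i) * f i t))
    has_real_derivative
      exp (-t) * (\<Sum>i\<le>Suc j. of_nat (Suc j choose i) * (-1) ^ (Suc j - i) * f i t)) (at t)"
proof -
  have "((\<lambda>t. \<Sum>i\<le>j. of_nat (j choose i) * (-1) ^ (j - i) * f i t) has_real_derivative
      (\<Sum>i\<le>j. of_nat (j choose i) * (-1) ^ (j - i) * f (Suc i) t)) (at t)"
    by (intro DERIV_sum DERIV_cmult assms)
  moreover have "((\<lambda>t. exp (-t)) has_real_derivative - exp (-t)) (at t)"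
    by (auto intro!: derivative_eq_intros)
  ultimately show ?thesis
    unfolding alternating_binomial_sum_Suc[where a = "\<lambda>i. f i t"]
    by - (rule DERIV_cong, erule (1) DERIV_mult'[rotated], simp add: sum_subtractf algebra_simps)
qed

lemma powr_mult_eq_power:
  fixes x :: real
  assumes "0 < \<alpha>" "0 < x"
  shows "x powr (real k * \<alpha>) = \<alpha> ^ k * (x powr \<alpha> / \<alpha>) ^ k"
proof -
  have "x powr (real k * \<alpha>) = (x powr \<alpha>) powr real k"
    by (simp add: powr_powr mult.commute)
  then show ?thesis
    using assms by (simp add: powr_realpow power_divide)
qed

lemma conf_assoc_laguerre_expansion:
  assumes "0 < \<alpha>" "0 < x"
  shows "conf_assoc_laguerre \<alpha> n m x =
    (\<Sum>k\<le>n. (-1) ^ k * of_nat ((n + m) choose (k + m)) * (x powr \<alpha> / \<alpha>) ^ k / fact k)"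
proof -
  define F where "F j t = (\<Sum>k\<le>n + m. (-1) ^ k * of_nat ((n + m) choose k) *
    divided_power_deriv k j t)" for j t
  have "conf_laguerre \<alpha> (n + m) y = F 0 (y powr \<alpha> / \<alpha>)" if "0 < y" for y
    unfolding conf_laguerre_def F_def atLeast0AtMost
    using that \<open>0 < \<alpha>\<close>
    by (intro sum.cong)
      (simp_all add: powr_mult_eq_power divided_power_deriv_def binomial_fact power2_eq_square, simp add: mult_ac)
  moreover have "(F j has_real_derivative F (Suc j) t) (at t)" for j t
    unfolding F_def [abs_def]
    by (intro DERIV_sum DERIV_cmult has_real_derivative_divided_power_deriv)
  ultimately have "(conf_deriv \<alpha> ^^ m) (conf_laguerre \<alpha> (n + m)) x = F m (x powr \<alpha> / \<alpha>)"
    using assms by (intro conf_deriv_funpow_eq) auto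
  \<comment> \<open>Terms with k < m are differentiated away. The lower bound is written
    \<open>0 + m\<close> to fit the index shift that follows.\<close>
  also have "\<dots> = (\<Sum>k\<in>{0 + m..n + m}. (-1) ^ k * of_nat ((n + m) choose k) *
      divided_power_deriv k m (x powr \<alpha> / \<alpha>))"
    unfolding F_def
    by (rule sum.mono_neutral_right) (auto simp: divided_power_deriv_def)
  also have "\<dots> = (-1) ^ m *
      (\<Sum>k\<le>n. (-1) ^ k * of_nat ((n + m) choose (k + m)) * (x powr \<alpha> / \<alpha>) ^ k / fact k)"
    unfolding sum.shift_bounds_cl_nat_ivl
    by (simp add: divided_power_deriv_def sum_distrib_left power_add mult_ac atLeast0AtMost)
  finally show ?thesis
    by (simp add: conf_assoc_laguerre_def flip: mult.assoc power_add)
qed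

lemma conf_deriv_funpow_power_exp:
  assumes "0 < \<alpha>" "0 < x"
  shows "(conf_deriv \<alpha> ^^ n) (\<lambda>y. y powr (real (n + m) * \<alpha>) * exp (- (y powr \<alpha> / \<alpha>))) x =
    \<alpha> ^ (n + m) * fact n * exp (- (x powr \<alpha> / \<alpha>)) * (x powr \<alpha> / \<alpha>) ^ m *
    (\<Sum>k\<le>n. (-1) ^ k * of_nat ((n + m) choose (k + m)) * (x powr \<alpha> / \<alpha>) ^ k / fact k)"
proof -
  let ?t = "x powr \<alpha> / \<alpha>"
  \<comment> \<open>The i-th derivative of (\<alpha> t)^(n+m), which is x^((n+m)\<alpha>) in the
    variable t; the factorial undoes the normalisation of the divided power.\<close>
  define f where "f i t = \<alpha> ^ (n + m) * fact (n + m) * divided_power_deriv (n + m) i t" for i t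
  define F where "F j t = exp (-t) *
    (\<Sum>i\<le>j. of_nat (j choose i) * (-1) ^ (j - i) * f i t)" for j t
  have "(F j has_real_derivative F (Suc j) t) (at t)" for j t
    unfolding F_def [abs_def] f_def
    by (intro has_real_derivative_leibniz_exp_neg DERIV_cmult
        has_real_derivative_divided_power_deriv)
  moreover have "y powr (real (n + m) * \<alpha>) * exp (- (y powr \<alpha> / \<alpha>)) = F 0 (y powr \<alpha> / \<alpha>)"
    if "0 < y" for y
    unfolding powr_mult_eq_power[OF \<open>0 < \<alpha>\<close> that] F_def f_def
    by (simp add: divided_power_deriv_def)
  ultimately have "(conf_deriv \<alpha> ^^ n)
      (\<lambda>y. y powr (real (n + m) * \<alpha>) * exp (- (y powr \<alpha> / \<alpha>))) x = F n ?t"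
    using assms by (intro conf_deriv_funpow_eq) auto
  \<comment> \<open>Reversing with i = n - k turns the power t^(n+m-i) into t^(m+k), so that t^m
    factors out.\<close>
  also have "\<dots> = exp (- ?t) * (\<Sum>k\<le>n. of_nat (n choose (n - k)) * (-1) ^ (n - (n - k)) * f (n - k) ?t)"
    unfolding F_def
    by (subst sum.nat_diff_reindex[symmetric, of _ "Suc n", unfolded lessThan_Suc_atMost]) simp
  also have "\<dots> = exp (- ?t) * (\<Sum>k\<le>n. \<alpha> ^ (n + m) * fact n * ?t ^ m *
      ((-1) ^ k * of_nat ((n + m) choose (k + m)) * ?t ^ k / fact k))"
  proof (intro arg_cong[where f = "(*) _"] sum.cong refl)
    fix k assume "k \<in> {..n}"
    then have k: "k \<le> n" by simp
    \<comment> \<open>With the truncated differences resolved, what remains is (n choose k)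
      (n+m)!/(k+m)! = n! (n+m choose k+m)/k!.\<close>
    have "n + m - (n - k) = k + m" "n + m - (k + m) = n - k" "n - (n - k) = k" "n - k \<le> n + m"
      using k by auto
    then show "of_nat (n choose (n - k)) * (-1) ^ (n - (n - k)) * f (n - k) ?t =
        \<alpha> ^ (n + m) * fact n * ?t ^ m *
        ((-1) ^ k * of_nat ((n + m) choose (k + m)) * ?t ^ k / fact k)"
      using k by (simp add: f_def divided_power_deriv_def binomial_fact power_add ac_simps)
  qed
  finally show ?thesis
    by (simp add: sum_distrib_left mult_ac)
qed

theorem mainTheorem7:
  fixes \<alpha> :: real and m n :: nat and x :: real
  assumes "0 < \<alpha>" and "\<alpha> \<le> 1" and "x > 0"
  shows "conf_assoc_laguerre \<alpha> n m x =
    x powr (- (real m * \<alpha>)) * exp (x powr \<alpha> / \<alpha>) / (\<alpha> ^ n * fact n) *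
    (conf_deriv \<alpha> ^^ n) (\<lambda>y. y powr (real (n + m) * \<alpha>) * exp (- (y powr \<alpha> / \<alpha>))) x"
proof -
  define t where "t = x powr \<alpha> / \<alpha>"
  have "t \<noteq> 0"
    using assms by (simp add: t_def)
  \<comment> \<open>Hence the prefactor is the inverse of \<alpha>^(n+m) n! e^(-t) t^m, the factor
    in front of the sum in \<open>conf_deriv_funpow_power_exp\<close>.\<close>
  moreover have "x powr (- (real m * \<alpha>)) = 1 / (\<alpha> ^ m * t ^ m)"
    using powr_mult_eq_power[of \<alpha> x m] assms by (simp add: powr_minus_divide t_def)
  ultimately show ?thesis
    using assms
    unfolding conf_assoc_laguerre_expansion[OF assms(1,3)]
      conf_deriv_funpow_power_exp[OF assms(1,3)] t_def[symmetric]
    by (simp add: exp_minus power_add field_simps)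
qed

end
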